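(* Let $D > E \geq 1$ be integers. Let $U \subseteq \mathbb{R}^D$ be a nonempty open set, and let $f: U \to \mathbb{R}^E$ be a continuous function. Then $f$ is not injective.
   Context: $\mathbb{R}^D$ and $\mathbb{R}^E$ carry their usual Euclidean topologies. *)

theory Defs
  imports "HOL-Analysis.Analysis"
begin

end

theory Submission
  imports Defs
begin

theorem theorem9p2:
  fixes U :: "(real ^ 'd) set"
    and f :: "real ^ 'd \<Rightarrow> real ^ 'e"
  assumes "CARD('d) > CARD('e)"
    and "CARD('e) \<ge> 1"
    and "open U"
    and "U \<noteq> {}"
    and "continuous_on U f"
  shows "\<not> inj_on f U"
proof
  assume "inj_on f U"
  \<comment> \<open>By Brouwer's invariance of domain: otherwise \<open>f\<close> followed by a
    linear embedding of the target as a proper subspace of \<open>real ^ 'd\<close> would be a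
    continuous injection on \<open>U\<close>, so its image would be open and nonempty, yet a proper
    subspace has empty interior.\<close>
  with assms have "DIM(real ^ 'd) \<le> DIM(real ^ 'e)"
    by (intro invariance_of_dimension)
  \<comment> \<open>\<open>DIM(real ^ 'd)\<close> evaluates to \<open>CARD('d)\<close>, and likewise
    for \<open>'e\<close>.\<close>
  with assms(1) show False
    by simp
qed

end
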